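(* Let $n\ge 2$ and let $\Gamma$ be a finite-index regular cover of the rose $\mathbf{R}_n$. Then the graph $\mathrm{HSC}_1(\Gamma)$ is connected if and only if $\mathrm{H}_1^{\mathrm{sep}}(\Gamma;\mathbb{Z})=\mathrm{H}_1(\Gamma;\mathbb{Z})$.
   Context: $\mathbf{F}_n$ is the free group on $X_n=\{x_1,\dots,x_n\}$, and $\mathbf{R}_n$ is the rose (graph with one vertex and $n$ edges), with $\pi_1(\mathbf{R}_n)$ identified with $\mathbf{F}_n$. For a finite regular cover $\Gamma\to\mathbf{R}_n$, $\pi_1(\Gamma)$ is identified with the corresponding finite-index normal subgroup of $\mathbf{F}_n$. A proper free factor of $\mathbf{F}_n$ is a nontrivial proper subgroup $F$ such that $\mathbf{F}_n=F*G$ for some nontrivial proper subgroup $G$; $\mathcal{C}^{\mathrm{sep}}$ is the set of elements of $\mathbf{F}_n$ lying in some proper free factor. $\mathrm{H}_1^{\mathrm{sep}}(\Gamma;\mathbb{Z})$ is the subgroup of $\mathrm{H}_1(\Gamma;\mathbb{Z})=\pi_1(\Gamma)^{\mathrm{ab}}$ generated by the homology classes of closed curves in $\Gamma$ whose image in $\mathbf{R}_n$ represents an element of $\mathcal{C}^{\mathrm{sep}}$; equivalently, by the images of the elements of $\mathcal{C}^{\mathrm{sep}}\cap\pi_1(\Gamma)$. $\mathrm{HSC}_1(\Gamma)$ is the directed graph defined as follows. Its vertices are the $\mathbf{F}_n$-conjugacy classes $[v]$ of elements $v\in\pi_1(\Gamma)$. Its edges are labeled by $\mathbf{F}_n$-conjugacy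 classes of elements of $E_1:=(\mathcal{C}^{\mathrm{sep}}\cap\pi_1(\Gamma))\cup[\pi_1(\Gamma),\pi_1(\Gamma)]$. For $\alpha\in E_1$ there is an edge labeled $[\alpha]$ from $[v]$ to $[w]$ if and only if there are $g\in[v]$, $h\in[w]$, $c\in\mathbf{F}_n$ such that $gc\alpha c^{-1}=h$. *)

theory Defs
  imports "HOL-Algebra.Generated_Groups" "Graph_Theory.Digraph_Component"
begin

section \<open>Free groups\<close>

text \<open>The letter \<open>(x, True)\<close> stands for the generator \<open>x\<close> and \<open>(x, False)\<close> for its inverse.\<close>

definition inv_letter :: "'a \<times> bool \<Rightarrow> 'a \<times> bool" where
  "inv_letter a = (fst a, \<not> snd a)"

definition inv_word :: "('a \<times> bool) list \<Rightarrow> ('a \<times> bool) list" where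
  "inv_word w = rev (map inv_letter w)"

definition reduced :: "('a \<times> bool) list \<Rightarrow> bool" where
  "reduced w \<longleftrightarrow> successively (\<lambda>a b. b \<noteq> inv_letter a) w"

fun push_letter :: "'a \<times> bool \<Rightarrow> ('a \<times> bool) list \<Rightarrow> ('a \<times> bool) list" where
  "push_letter a [] = [a]"
| "push_letter a (b # w) = (if b = inv_letter a then w else a # b # w)"

definition reduce :: "('a \<times> bool) list \<Rightarrow> ('a \<times> bool) list" where
  "reduce w = foldr push_letter w []"

definition free_group :: "'a set \<Rightarrow> ('a \<times> bool) list monoid" where
  "free_group X =
     \<lparr>carrier = {w. fst ` set w \<subseteq> X \<and> reduced w},
      monoid.mult = (\<lambda>u v. reduce (u @ v)),
      one = []\<rparr>"

lemma inv_letter_inv_letter [simp]: "inv_letter (inv_letter a) = a"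
  by (simp add: inv_letter_def)

lemma inv_letter_neq [simp]: "inv_letter a \<noteq> a" "a \<noteq> inv_letter a"
  by (auto simp: inv_letter_def prod_eq_iff)

lemma reduced_Nil [simp]: "reduced []"
  by (simp add: reduced_def)

lemma reduced_Cons:
  "reduced (a # w) \<longleftrightarrow> reduced w \<and> (w = [] \<or> hd w \<noteq> inv_letter a)"
  by (cases w) (auto simp: reduced_def)

lemma reduced_push_letter: "reduced w \<Longrightarrow> reduced (push_letter a w)"
  by (cases w) (auto simp: reduced_Cons)

lemma reduced_foldr_push: "reduced w \<Longrightarrow> reduced (foldr push_letter u w)"
  by (induction u) (auto intro: reduced_push_letter)

lemma reduced_reduce: "reduced (reduce w)"
  by (simp add: reduce_def reduced_foldr_push)

lemma reduce_reduced: "reduced w \<Longrightarrow> reduce w = w"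
proof (induction w)
  case (Cons a w)
  then have "reduce (a # w) = push_letter a w"
    by (simp add: reduce_def reduced_Cons)
  then show ?case
    using Cons.prems by (cases w) (auto simp: reduced_Cons)
qed (simp add: reduce_def)

lemma push_letter_cancel:
  "reduced w \<Longrightarrow> push_letter a (push_letter (inv_letter a) w) = w"
  by (cases w; cases "tl w") (auto simp: reduced_Cons)

lemma foldr_push_push_letter:
  "reduced w \<Longrightarrow>
     foldr push_letter (push_letter a u) w = push_letter a (foldr push_letter u w)"
proof (cases u)
  case (Cons b u')
  assume "reduced w"
  then show ?thesis
    using Cons push_letter_cancel[OF reduced_foldr_push, of w a u'] by auto
qed simp

lemma foldr_push_reduce:
  "reduced w \<Longrightarrow> foldr push_letter (reduce u) w = foldr push_letter u w"
  by (induction u) (simp_all add: reduce_def foldr_push_push_letter)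

lemma reduce_append_left: "reduce (reduce u @ v) = reduce (u @ v)"
  using foldr_push_reduce[OF reduced_reduce, of u v] by (simp add: reduce_def)

lemma reduce_append_right: "reduce (u @ reduce v) = reduce (u @ v)"
  using reduce_reduced[OF reduced_reduce, of v] by (simp add: reduce_def)

lemma set_push_letter: "set (push_letter a w) \<subseteq> insert a (set w)"
  by (cases w) auto

lemma set_reduce: "set (reduce w) \<subseteq> set w"
  using set_push_letter by (induction w) (fastforce simp: reduce_def)+

lemma reduce_inv_word: "reduce (inv_word w @ w) = []"
proof (induction w)
  case (Cons a w)
  have "push_letter (inv_letter a) (push_letter a (foldr push_letter w [])) = foldr push_letter w []"
    using push_letter_cancel[OF reduced_foldr_push[OF reduced_Nil], of "inv_letter a" w] by simp
  then show ?case
    using Cons by (simp add: reduce_def inv_word_def)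
qed (simp add: reduce_def inv_word_def)

lemma group_free_group: "group (free_group X)"
proof (rule groupI)
  fix w assume w: "w \<in> carrier (free_group X)"
  have "set (reduce (inv_word w)) \<subseteq> inv_letter ` set w"
    using set_reduce[of "inv_word w"] by (auto simp: inv_word_def)
  then have "reduce (inv_word w) \<in> carrier (free_group X)"
    using w by (fastforce simp: free_group_def reduced_reduce inv_letter_def)
  moreover have "reduce (reduce (inv_word w) @ w) = []"
    by (simp add: reduce_append_left reduce_inv_word)
  ultimately show "\<exists>v\<in>carrier (free_group X). v \<otimes>\<^bsub>free_group X\<^esub> w = \<one>\<^bsub>free_group X\<^esub>"
    by (auto simp: free_group_def)
next
  fix u v assume "u \<in> carrier (free_group X)" "v \<in> carrier (free_group X)"
  then show "u \<otimes>\<^bsub>free_group X\<^esub> v \<in> carrier (free_group X)"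
    using set_reduce[of "u @ v"] by (fastforce simp: free_group_def reduced_reduce)
qed (auto simp: free_group_def reduce_reduced reduce_append_left reduce_append_right)

abbreviation F :: "nat \<Rightarrow> (nat \<times> bool) list monoid" where
  "F n \<equiv> free_group {1..n}"


section \<open>Free factors\<close>

text \<open>
  The elements of the free product of \<open>A\<close> and \<open>B\<close> are the alternating words in the nontrivial
  elements of \<open>A\<close> (tagged \<open>Inl\<close>) and of \<open>B\<close> (tagged \<open>Inr\<close>). \<open>G\<close> is the internal free product of
  its subgroups \<open>A\<close> and \<open>B\<close> if the natural map from the free product to \<open>G\<close>, which multiplies
  out a word, is bijective.
\<close>

definition alternating_words :: "('a, 'm) monoid_scheme \<Rightarrow> 'a set \<Rightarrow> 'a set \<Rightarrow> ('a + 'a) list set" where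
  "alternating_words G A B =
     {ws. set ws \<subseteq> (A - {\<one>\<^bsub>G\<^esub>}) <+> (B - {\<one>\<^bsub>G\<^esub>}) \<and> successively (\<lambda>a b. isl a \<noteq> isl b) ws}"

definition word_product :: "('a, 'm) monoid_scheme \<Rightarrow> ('a + 'a) list \<Rightarrow> 'a" where
  "word_product G ws = foldr (\<lambda>a y. case_sum id id a \<otimes>\<^bsub>G\<^esub> y) ws \<one>\<^bsub>G\<^esub>"

definition is_free_product :: "('a, 'm) monoid_scheme \<Rightarrow> 'a set \<Rightarrow> 'a set \<Rightarrow> bool" where
  "is_free_product G A B \<longleftrightarrow>
     subgroup A G \<and> subgroup B G \<and>
     bij_betw (word_product G) (alternating_words G A B) (carrier G)"

definition proper_free_factor :: "('a, 'm) monoid_scheme \<Rightarrow> 'a set \<Rightarrow> bool" where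
  "proper_free_factor G A \<longleftrightarrow>
     subgroup A G \<and> A \<noteq> {\<one>\<^bsub>G\<^esub>} \<and> A \<noteq> carrier G \<and>
     (\<exists>B. subgroup B G \<and> B \<noteq> {\<one>\<^bsub>G\<^esub>} \<and> B \<noteq> carrier G \<and> is_free_product G A B)"

definition C_sep :: "nat \<Rightarrow> (nat \<times> bool) list set" where
  "C_sep n = {x. \<exists>A. proper_free_factor (F n) A \<and> x \<in> A}"


section \<open>Covers of graphs\<close>

text \<open>
  Graphs are oriented: each edge carries a preferred direction, but edge paths may traverse it
  either way. A cover of the rose inherits its orientation from the orientation of the rose, so a
  covering map may be assumed to preserve orientations. It is given by a map \<open>p\<close> on vertices and a
  map \<open>q\<close> on edges that is bijective on the star of every vertex. Covers are connected.
\<close>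

definition rose :: "nat \<Rightarrow> (unit, nat) pre_digraph" where
  "rose n = \<lparr>verts = {()}, arcs = {1..n}, tail = (\<lambda>_. ()), head = (\<lambda>_. ())\<rparr>"

definition covering_map ::
  "('v, 'e) pre_digraph \<Rightarrow> ('w, 'd) pre_digraph \<Rightarrow> ('v \<Rightarrow> 'w) \<Rightarrow> ('e \<Rightarrow> 'd) \<Rightarrow> bool" where
  "covering_map \<Gamma> G p q \<longleftrightarrow>
     wf_digraph \<Gamma> \<and> wf_digraph G \<and> Digraph_Component.connected \<Gamma> \<and>
     p ` verts \<Gamma> = verts G \<and> q ` arcs \<Gamma> \<subseteq> arcs G \<and>
     (\<forall>e\<in>arcs \<Gamma>. tail G (q e) = p (tail \<Gamma> e) \<and> head G (q e) = p (head \<Gamma> e)) \<and>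
     (\<forall>v\<in>verts \<Gamma>.
        bij_betw q {e \<in> arcs \<Gamma>. tail \<Gamma> e = v} {d \<in> arcs G. tail G d = p v} \<and>
        bij_betw q {e \<in> arcs \<Gamma>. head \<Gamma> e = v} {d \<in> arcs G. head G d = p v})"

definition deck_transformation ::
  "('v, 'e) pre_digraph \<Rightarrow> ('v \<Rightarrow> 'w) \<Rightarrow> ('e \<Rightarrow> 'd) \<Rightarrow> ('v \<Rightarrow> 'v) \<Rightarrow> ('e \<Rightarrow> 'e) \<Rightarrow> bool" where
  "deck_transformation \<Gamma> p q f g \<longleftrightarrow>
     bij_betw f (verts \<Gamma>) (verts \<Gamma>) \<and> bij_betw g (arcs \<Gamma>) (arcs \<Gamma>) \<and>
     (\<forall>e\<in>arcs \<Gamma>. tail \<Gamma> (g e) = f (tail \<Gamma> e) \<and> head \<Gamma> (g e) = f (head \<Gamma> e)) \<and>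
     (\<forall>v\<in>verts \<Gamma>. p (f v) = p v) \<and> (\<forall>e\<in>arcs \<Gamma>. q (g e) = q e)"

definition regular_cover ::
  "('v, 'e) pre_digraph \<Rightarrow> ('w, 'd) pre_digraph \<Rightarrow> ('v \<Rightarrow> 'w) \<Rightarrow> ('e \<Rightarrow> 'd) \<Rightarrow> bool" where
  "regular_cover \<Gamma> G p q \<longleftrightarrow>
     covering_map \<Gamma> G p q \<and>
     (\<forall>u\<in>verts \<Gamma>. \<forall>v\<in>verts \<Gamma>. p u = p v \<longrightarrow> (\<exists>f g. deck_transformation \<Gamma> p q f g \<and> f u = v))"

text \<open>The index of a cover is the number of its sheets, i.e. the cardinality of its fibres.\<close>

definition finite_index_cover ::
  "('v, 'e) pre_digraph \<Rightarrow> ('w, 'd) pre_digraph \<Rightarrow> ('v \<Rightarrow> 'w) \<Rightarrow> bool" where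
  "finite_index_cover \<Gamma> G p \<longleftrightarrow> (\<forall>x\<in>verts G. finite {v \<in> verts \<Gamma>. p v = x})"

text \<open>An entry \<open>(e, True)\<close> of an edge path traverses \<open>e\<close> forwards, \<open>(e, False)\<close> backwards.\<close>

fun edge_path :: "('v, 'e) pre_digraph \<Rightarrow> 'v \<Rightarrow> ('e \<times> bool) list \<Rightarrow> 'v \<Rightarrow> bool" where
  "edge_path \<Gamma> u [] v \<longleftrightarrow> u \<in> verts \<Gamma> \<and> u = v"
| "edge_path \<Gamma> u ((e, s) # \<gamma>) v \<longleftrightarrow>
     e \<in> arcs \<Gamma> \<and> u = (if s then tail \<Gamma> e else head \<Gamma> e) \<and>
     edge_path \<Gamma> (if s then head \<Gamma> e else tail \<Gamma> e) \<gamma> v"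

text \<open>
  The image in \<open>rose n\<close> of an edge path of a cover is a closed path; this is the element of
  \<open>F n\<close> that it represents.
\<close>

definition path_image :: "('e \<Rightarrow> nat) \<Rightarrow> ('e \<times> bool) list \<Rightarrow> (nat \<times> bool) list" where
  "path_image q \<gamma> = reduce (map (map_prod q id) \<gamma>)"


section \<open>Homology\<close>

text \<open>
  Throughout, the fundamental group of a cover \<open>\<Gamma>\<close> of \<open>rose n\<close>, based at \<open>v\<^sub>0\<close>, is identified with
  its image in \<open>F n\<close>, and the first homology group is its abelianization.
\<close>

definition \<pi>\<^sub>1 :: "('v, 'e) pre_digraph \<Rightarrow> ('e \<Rightarrow> nat) \<Rightarrow> 'v \<Rightarrow> (nat \<times> bool) list set" where
  "\<pi>\<^sub>1 \<Gamma> q v\<^sub>0 = {path_image q \<gamma> |\<gamma>. edge_path \<Gamma> v\<^sub>0 \<gamma> v\<^sub>0}"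

definition H\<^sub>1 ::
  "nat \<Rightarrow> ('v, 'e) pre_digraph \<Rightarrow> ('e \<Rightarrow> nat) \<Rightarrow> 'v \<Rightarrow> (nat \<times> bool) list set monoid" where
  "H\<^sub>1 n \<Gamma> q v\<^sub>0 = (F n\<lparr>carrier := \<pi>\<^sub>1 \<Gamma> q v\<^sub>0\<rparr>) Mod derived (F n) (\<pi>\<^sub>1 \<Gamma> q v\<^sub>0)"

definition homology_class ::
  "nat \<Rightarrow> ('v, 'e) pre_digraph \<Rightarrow> ('e \<Rightarrow> nat) \<Rightarrow> 'v \<Rightarrow> (nat \<times> bool) list \<Rightarrow> (nat \<times> bool) list set" where
  "homology_class n \<Gamma> q v\<^sub>0 x = derived (F n) (\<pi>\<^sub>1 \<Gamma> q v\<^sub>0) #>\<^bsub>F n\<^esub> x"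

text \<open>
  The homology class of a closed path \<open>\<gamma>\<close> at a vertex \<open>u\<close> is obtained by joining \<open>\<gamma>\<close> to the base
  point by a path \<open>\<delta>\<close> from \<open>v\<^sub>0\<close> to \<open>u\<close>; it does not depend on the choice of \<open>\<delta>\<close>.
\<close>

definition H\<^sub>1_sep ::
  "nat \<Rightarrow> ('v, 'e) pre_digraph \<Rightarrow> ('e \<Rightarrow> nat) \<Rightarrow> 'v \<Rightarrow> (nat \<times> bool) list set set" where
  "H\<^sub>1_sep n \<Gamma> q v\<^sub>0 = generate (H\<^sub>1 n \<Gamma> q v\<^sub>0)
     {homology_class n \<Gamma> q v\<^sub>0 (path_image q (\<delta> @ \<gamma> @ inv_word \<delta>)) |u \<delta> \<gamma>.
        edge_path \<Gamma> v\<^sub>0 \<delta> u \<and> edge_path \<Gamma> u \<gamma> u \<and> path_image q \<gamma> \<in> C_sep n}"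


section \<open>The graph \<open>HSC\<^sub>1\<close>\<close>

definition conjugacy_class :: "('a, 'm) monoid_scheme \<Rightarrow> 'a \<Rightarrow> 'a set" where
  "conjugacy_class G x = {c \<otimes>\<^bsub>G\<^esub> x \<otimes>\<^bsub>G\<^esub> inv\<^bsub>G\<^esub> c |c. c \<in> carrier G}"

definition E\<^sub>1 :: "nat \<Rightarrow> ('v, 'e) pre_digraph \<Rightarrow> ('e \<Rightarrow> nat) \<Rightarrow> 'v \<Rightarrow> (nat \<times> bool) list set" where
  "E\<^sub>1 n \<Gamma> q v\<^sub>0 = (C_sep n \<inter> \<pi>\<^sub>1 \<Gamma> q v\<^sub>0) \<union> derived (F n) (\<pi>\<^sub>1 \<Gamma> q v\<^sub>0)"

text \<open>An edge is a triple consisting of its initial vertex, its label and its terminal vertex.\<close>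

definition HSC\<^sub>1 ::
  "nat \<Rightarrow> ('v, 'e) pre_digraph \<Rightarrow> ('e \<Rightarrow> nat) \<Rightarrow> 'v \<Rightarrow>
   ((nat \<times> bool) list set,
    (nat \<times> bool) list set \<times> (nat \<times> bool) list set \<times> (nat \<times> bool) list set) pre_digraph" where
  "HSC\<^sub>1 n \<Gamma> q v\<^sub>0 =
     \<lparr>verts = conjugacy_class (F n) ` \<pi>\<^sub>1 \<Gamma> q v\<^sub>0,
      arcs = {(conjugacy_class (F n) v, conjugacy_class (F n) \<alpha>, conjugacy_class (F n) w) |v \<alpha> w.
        v \<in> \<pi>\<^sub>1 \<Gamma> q v\<^sub>0 \<and> \<alpha> \<in> E\<^sub>1 n \<Gamma> q v\<^sub>0 \<and> w \<in> \<pi>\<^sub>1 \<Gamma> q v\<^sub>0 \<and>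
        (\<exists>g\<in>conjugacy_class (F n) v. \<exists>h\<in>conjugacy_class (F n) w. \<exists>c\<in>carrier (F n).
           g \<otimes>\<^bsub>F n\<^esub> (c \<otimes>\<^bsub>F n\<^esub> \<alpha> \<otimes>\<^bsub>F n\<^esub> inv\<^bsub>F n\<^esub> c) = h)},
      tail = fst,
      head = (\<lambda>(v, \<alpha>, w). w)\<rparr>"

end

theory Submission
  imports Defs
begin

text \<open>
  Let \<open>P\<close> be the fundamental group of the cover, a normal subgroup of the free group, and let \<open>S\<close>
  be the subgroup generated by the labels \<open>E\<^sub>1\<close>. Since \<open>C_sep\<close> is invariant under conjugation, \<open>S\<close> is
  normal, so a conjugacy class contained in \<open>S\<close> has all its neighbours in \<open>S\<close>; conversely,
  multiplying by a word in the labels traces out a path. Hence the graph is connected iff \<open>S = P\<close>.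
  Since \<open>S\<close> contains the commutator subgroup of \<open>P\<close>, and \<open>H\<^sub>1_sep\<close> is the image of \<open>S\<close> in the
  abelianization of \<open>P\<close>, this means that \<open>H\<^sub>1_sep\<close> is everything.
\<close>

text \<open>Otherwise the simplifier rewrites \<open>F n\<close> to \<open>free_group {Suc 0..n}\<close>, and the group laws no longer match.\<close>

declare One_nat_def [simp del]


section \<open>Groups\<close>

lemma (in group) inv_cancel_left:
  assumes "x \<in> carrier G" "y \<in> carrier G"
  shows "inv x \<otimes> (x \<otimes> y) = y" "x \<otimes> (inv x \<otimes> y) = y"
  using assms by (simp_all flip: m_assoc)

text \<open>Meant for the edges of the graph: their ends have representatives that differ by a right
  factor, which can also be cancelled by its inverse.\<close>

lemma (in group) mult_in_subgroup_iff:
  assumes H: "subgroup H G" and g: "g \<in> carrier G" and a: "a \<in> H"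
  shows "g \<otimes> a \<in> H \<longleftrightarrow> g \<in> H"
proof
  interpret subgroup H G by fact
  have "g \<otimes> a \<otimes> inv a = g"
    using g a by (simp add: m_assoc)
  then show "g \<in> H" if "g \<otimes> a \<in> H"
    using that a m_closed m_inv_closed by metis
qed (use a subgroup.m_closed[OF H] in blast)

text \<open>Supplies the automorphism that carries a free factor to its conjugate.\<close>

lemma (in group) conjugation_iso:
  assumes c: "c \<in> carrier G"
  shows "(\<lambda>x. c \<otimes> x \<otimes> inv c) \<in> iso G G"
proof (rule isoI)
  show "(\<lambda>x. c \<otimes> x \<otimes> inv c) \<in> hom G G"
  proof (rule homI)
    fix x y assume "x \<in> carrier G" "y \<in> carrier G"
    then show "c \<otimes> (x \<otimes> y) \<otimes> inv c = c \<otimes> x \<otimes> inv c \<otimes> (c \<otimes> y \<otimes> inv c)"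
      using c by (simp add: m_assoc inv_cancel_left)
  qed (use c in simp)
  show "bij_betw (\<lambda>x. c \<otimes> x \<otimes> inv c) (carrier G) (carrier G)"
    by (rule bij_betwI[where g = "\<lambda>x. inv c \<otimes> x \<otimes> c"])
      (use c in \<open>auto simp: m_assoc inv_cancel_left\<close>)
qed

section \<open>Conjugacy classes and normal subgroups\<close>

lemma (in group) conjugacy_class_self: "x \<in> carrier G \<Longrightarrow> x \<in> conjugacy_class G x"
  by (force simp: conjugacy_class_def intro: exI[of _ \<one>])

lemma (in group) conjugacy_class_normal:
  assumes "N \<lhd> G" "x \<in> N"
  shows "conjugacy_class G x \<subseteq> N"
  using normal_invE(2)[OF assms(1)] assms(2) by (auto simp: conjugacy_class_def)

lemma (in group) conjugacy_class_sym:
  assumes "x \<in> carrier G" "y \<in> conjugacy_class G x"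
  shows "x \<in> conjugacy_class G y"
proof -
  from assms(2) obtain c where c: "c \<in> carrier G" "y = c \<otimes> x \<otimes> inv c"
    by (auto simp: conjugacy_class_def)
  then have "x = inv c \<otimes> y \<otimes> inv (inv c)"
    using assms(1) by (simp add: m_assoc inv_cancel_left)
  with c(1) show ?thesis
    unfolding conjugacy_class_def by blast
qed

text \<open>A normal subgroup is a union of conjugacy classes, so membership can be tested on any
  representative of a vertex.\<close>

lemma (in group) conjugacy_class_mem_normal_iff:
  assumes "N \<lhd> G" "x \<in> carrier G" "g \<in> conjugacy_class G x"
  shows "g \<in> N \<longleftrightarrow> x \<in> N"
  using conjugacy_class_normal[OF assms(1)] conjugacy_class_sym[OF assms(2,3)] assms(3) by blast

text \<open>Correspondence of subgroups: the image of \<open>C\<close> generates the image of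
  \<open>generate G C\<close>, and the full preimage of the latter is the subgroup generated by
  \<open>C\<close> and \<open>H\<close> together.\<close>

lemma (in normal) generate_FactGroup_eq_carrier_iff:
  assumes C: "C \<subseteq> carrier G"
  shows "generate (G Mod H) ((#>) H ` C) = carrier (G Mod H) \<longleftrightarrow> generate G (C \<union> H) = carrier G"
proof -
  interpret h: group_hom G "G Mod H" "(#>) H"
    using r_coset_hom_Mod factorgroup_is_group
    by (intro group_hom.intro group_hom_axioms.intro) (auto intro: is_group)
  have CH: "C \<union> H \<subseteq> carrier G"
    using C subset by blast
  have carr: "carrier (G Mod H) = (#>) H ` carrier G"
    by (auto simp: FactGroup_def RCOSETS_def)
  have img: "generate (G Mod H) ((#>) H ` C) = (#>) H ` generate G C"
    using h.generate_img[OF C] .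
  show ?thesis
  proof
    assume L: "generate (G Mod H) ((#>) H ` C) = carrier (G Mod H)"
    have "x \<in> generate G (C \<union> H)" if x: "x \<in> carrier G" for x
    proof -
      obtain y where y: "y \<in> generate G C" "H #> x = H #> y"
        using L x unfolding img carr by blast
      \<comment> \<open>Equal cosets differ by a left factor from \<open>H\<close>, which turns a
        word in \<open>C\<close> into a word in \<open>C \<union> H\<close>.\<close>
      have "x \<in> H #> y"
        using rcos_self[OF x subgroup_axioms] y(2) by simp
      then obtain k where k: "k \<in> H" "x = k \<otimes> y"
        by (auto simp: r_coset_def)
      then show ?thesis
        using y(1) mono_generate[of C "C \<union> H"]
        by (auto intro!: generate.eng intro: generate.incl)
    qed
    then show "generate G (C \<union> H) = carrier G"
      using generate_incl[OF CH] by blast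
  next
    assume R: "generate G (C \<union> H) = carrier G"
    have sub: "subgroup ((#>) H ` generate G C) (G Mod H)"
      using h.subgroup_img_is_subgroup[OF generate_is_subgroup[OF C]] .
    \<comment> \<open>Every element of \<open>H\<close> maps to the trivial coset, so adding
      \<open>H\<close> to the generators does not enlarge the image.\<close>
    have "(#>) H ` (C \<union> H) \<subseteq> (#>) H ` generate G C"
    proof -
      have "H #> x \<in> (#>) H ` generate G C" if "x \<in> H" for x
      proof -
        have "H #> x = H #> \<one>"
          using that subset coset_join2[OF _ subgroup_axioms] by (auto simp: coset_mult_one)
        then show ?thesis
          using generate.one by (rule image_eqI)
      qed
      then show ?thesis
        by (auto intro: generate.incl)
    qed
    then have "generate (G Mod H) ((#>) H ` (C \<union> H)) \<subseteq> (#>) H ` generate G C"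
      using h.H.generate_subgroup_incl[OF _ sub] by blast
    then show "generate (G Mod H) ((#>) H ` C) = carrier (G Mod H)"
      unfolding h.generate_img[OF CH] img R carr using generate_incl[OF C] by blast
  qed
qed


section \<open>Free factors\<close>

text \<open>Induction on the word. Both facts are proved together, since the homomorphism law may be
  applied only to a partial product known to lie in the carrier.\<close>

lemma word_product_map:
  assumes "group G" "group H" "\<phi> \<in> hom G H"
    and "set ws \<subseteq> carrier G <+> carrier G"
  shows "word_product H (map (map_sum \<phi> \<phi>) ws) = \<phi> (word_product G ws)"
    and "word_product G ws \<in> carrier G"
proof -
  interpret group_hom G H \<phi>
    using assms(1-3) by (intro group_hom.intro group_hom_axioms.intro)
  have "word_product H (map (map_sum \<phi> \<phi>) ws) = \<phi> (word_product G ws)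
      \<and> word_product G ws \<in> carrier G"
    using assms(4) by (induction ws) (auto simp: word_product_def)
  then show "word_product H (map (map_sum \<phi> \<phi>) ws) = \<phi> (word_product G ws)"
    and "word_product G ws \<in> carrier G"
    by simp_all
qed

text \<open>An injective homomorphism sends nontrivial elements to nontrivial ones, and
  \<open>map_sum\<close> keeps the tags, so alternation is preserved and reflected.\<close>

lemma alternating_words_iso:
  assumes "group G" "group H" "\<phi> \<in> iso G H" "A \<subseteq> carrier G" "B \<subseteq> carrier G"
  shows "bij_betw (map (map_sum \<phi> \<phi>)) (alternating_words G A B)
    (alternating_words H (\<phi> ` A) (\<phi> ` B))"
proof -
  interpret group_hom G H \<phi>
    using assms(1-3) by (auto intro!: group_hom.intro group_hom_axioms.intro simp: iso_def)
  have inj: "inj_on \<phi> (carrier G)"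
    using assms(3) by (simp add: iso_def bij_betw_def)
  have diff: "\<phi> ` K - {\<one>\<^bsub>H\<^esub>} = \<phi> ` (K - {\<one>\<^bsub>G\<^esub>})" if "K \<subseteq> carrier G" for K
    using that inj inj_on_eq_iff[OF inj] by (auto simp: subset_iff) (metis G.one_closed hom_one)
  let ?X = "(A - {\<one>\<^bsub>G\<^esub>}) <+> (B - {\<one>\<^bsub>G\<^esub>})"
  let ?Y = "(\<phi> ` A - {\<one>\<^bsub>H\<^esub>}) <+> (\<phi> ` B - {\<one>\<^bsub>H\<^esub>})"
  have Y: "?Y = map_sum \<phi> \<phi> ` ?X"
    unfolding diff[OF assms(4)] diff[OF assms(5)] by (simp add: Plus_def image_Un image_image)
  have "inj_on (map_sum \<phi> \<phi>) ?X"
    using inj_on_subset[OF inj assms(4)] inj_on_subset[OF inj assms(5)]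
    by (intro inj_onI) (auto dest: inj_onD)
  then have injl: "inj_on (map (map_sum \<phi> \<phi>)) (lists ?X)"
    by (rule inj_on_mapI[OF inj_on_subset]) auto
  have succ: "successively (\<lambda>a b. isl a \<noteq> isl b) (map (map_sum \<phi> \<phi>) ws)
      \<longleftrightarrow> successively (\<lambda>a b. isl a \<noteq> isl b) ws" for ws :: "('a + 'a) list"
    by (simp add: successively_map isl_map_sum)
  have alt: "alternating_words G A B = {ws \<in> lists ?X. successively (\<lambda>a b. isl a \<noteq> isl b) ws}"
    by (auto simp: alternating_words_def)
  have alt': "alternating_words H (\<phi> ` A) (\<phi> ` B)
      = {ws \<in> map (map_sum \<phi> \<phi>) ` lists ?X. successively (\<lambda>a b. isl a \<noteq> isl b) ws}"
    unfolding lists_image[symmetric] Y[symmetric] by (auto simp: alternating_words_def)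
  show ?thesis
    unfolding bij_betw_def alt alt'
    using succ by (auto intro: inj_on_subset[OF injl])
qed

text \<open>In the commuting square formed by the two multiplication maps, \<phi> and the letterwise
  map, three sides are bijective, hence so is the fourth.\<close>

lemma is_free_product_iso:
  assumes "group G" "group H" "\<phi> \<in> iso G H" "is_free_product G A B"
  shows "is_free_product H (\<phi> ` A) (\<phi> ` B)"
proof -
  interpret group_hom G H \<phi>
    using assms(1-3) by (auto intro!: group_hom.intro group_hom_axioms.intro simp: iso_def)
  have A: "subgroup A G" and B: "subgroup B G"
    and bij: "bij_betw (word_product G) (alternating_words G A B) (carrier G)"
    using assms(4) by (auto simp: is_free_product_def)
  note sub = subgroup.subset[OF A] subgroup.subset[OF B]
  have "bij_betw (\<phi> \<circ> word_product G) (alternating_words G A B) (carrier H)"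
    using bij_betw_trans[OF bij] assms(3) by (simp add: iso_def)
  moreover have "word_product H (map (map_sum \<phi> \<phi>) ws) = \<phi> (word_product G ws)"
    if "ws \<in> alternating_words G A B" for ws
    using that sub
    by (intro word_product_map(1)[OF assms(1,2) homh]) (auto simp: alternating_words_def)
  ultimately have "bij_betw (word_product H \<circ> map (map_sum \<phi> \<phi>)) (alternating_words G A B) (carrier H)"
    by (subst bij_betw_cong[where g = "\<phi> \<circ> word_product G"]) auto
  then have "bij_betw (word_product H) (alternating_words H (\<phi> ` A) (\<phi> ` B)) (carrier H)"
    using bij_betw_comp_iff[OF alternating_words_iso[OF assms(1-3) sub]] by blast
  then show ?thesis
    using A B subgroup_img_is_subgroup by (simp add: is_free_product_def)
qed

lemma proper_free_factor_iso:
  assumes "group G" "group H" "\<phi> \<in> iso G H" "proper_free_factor G A"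
  shows "proper_free_factor H (\<phi> ` A)"
proof -
  interpret group_hom G H \<phi>
    using assms(1-3) by (auto intro!: group_hom.intro group_hom_axioms.intro simp: iso_def)
  have inj: "inj_on \<phi> (carrier G)" and surj: "\<phi> ` carrier G = carrier H"
    using assms(3) by (auto simp: iso_def bij_betw_def)
  \<comment> \<open>By injectivity, \<phi> distinguishes \<open>K\<close> from the trivial subgroup
    and from the whole group, whose images are the trivial subgroup and the whole of
    \<open>H\<close>.\<close>
  have proper: "\<phi> ` K \<noteq> {\<one>\<^bsub>H\<^esub>} \<and> \<phi> ` K \<noteq> carrier H"
    if "subgroup K G" "K \<noteq> {\<one>\<^bsub>G\<^esub>}" "K \<noteq> carrier G" for K
    using that inj_on_image_eq_iff[OF inj subgroup.subset[OF that(1)], of "{\<one>\<^bsub>G\<^esub>}"]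
      inj_on_image_eq_iff[OF inj subgroup.subset[OF that(1)], of "carrier G"] surj
    by auto
  show ?thesis
    using assms(4) proper is_free_product_iso[OF assms(1-3)] subgroup_img_is_subgroup
    unfolding proper_free_factor_def by (metis (no_types))
qed

section \<open>Conjugation invariance of \<open>C_sep\<close>\<close>

lemma C_sep_subset: "C_sep n \<subseteq> carrier (F n)"
  by (auto simp: C_sep_def proper_free_factor_def dest: subgroup.subset)

text \<open>If \<open>x\<close> lies in a proper free factor \<open>A\<close>, its conjugate lies in
  the conjugate of \<open>A\<close>, again a proper free factor.\<close>

lemma C_sep_conj:
  assumes "x \<in> C_sep n" "c \<in> carrier (F n)"
  shows "c \<otimes>\<^bsub>F n\<^esub> x \<otimes>\<^bsub>F n\<^esub> inv\<^bsub>F n\<^esub> c \<in> C_sep n"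
proof -
  obtain A where "proper_free_factor (F n) A" "x \<in> A"
    using assms(1) by (auto simp: C_sep_def)
  then show ?thesis
    using proper_free_factor_iso[OF group_free_group group_free_group
        group.conjugation_iso[OF group_free_group assms(2)]]
    by (auto simp: C_sep_def)
qed


section \<open>The fundamental group of a cover of the rose\<close>

lemma covering_map_wf: "covering_map \<Gamma> G p q \<Longrightarrow> wf_digraph \<Gamma>"
  unfolding covering_map_def by blast

text \<open>All arcs of the rose start and end at its only vertex, so the bijections on stars reach
  every generator.\<close>

lemma covering_map_rose:
  assumes "covering_map \<Gamma> (rose n) p q"
  shows "q ` arcs \<Gamma> \<subseteq> {1..n}"
    and "u \<in> verts \<Gamma> \<Longrightarrow> q ` {e \<in> arcs \<Gamma>. tail \<Gamma> e = u} = {1..n}"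
    and "u \<in> verts \<Gamma> \<Longrightarrow> q ` {e \<in> arcs \<Gamma>. head \<Gamma> e = u} = {1..n}"
  using assms unfolding covering_map_def bij_betw_def rose_def by auto

section \<open>Edge paths and their lifts\<close>

lemma edge_path_end_in_verts: "edge_path \<Gamma> u \<gamma> v \<Longrightarrow> v \<in> verts \<Gamma>"
  by (induction \<Gamma> u \<gamma> v rule: edge_path.induct) auto

lemma edge_path_arcs: "edge_path \<Gamma> u \<gamma> v \<Longrightarrow> fst ` set \<gamma> \<subseteq> arcs \<Gamma>"
  by (induction \<Gamma> u \<gamma> v rule: edge_path.induct) auto

lemma edge_path_append:
  assumes "edge_path \<Gamma> u \<gamma> v" "edge_path \<Gamma> v \<delta> w"
  shows "edge_path \<Gamma> u (\<gamma> @ \<delta>) w"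
  using assms by (induction \<Gamma> u \<gamma> v rule: edge_path.induct) auto

lemma edge_path_inv_word:
  assumes "wf_digraph \<Gamma>" "edge_path \<Gamma> u \<gamma> v"
  shows "edge_path \<Gamma> v (inv_word \<gamma>) u"
  using assms(2)
proof (induction \<gamma> arbitrary: u)
  case (Cons a \<gamma>)
  obtain e s where a: "a = (e, s)"
    by fastforce
  interpret wf_digraph \<Gamma> by fact
  have "edge_path \<Gamma> (if s then head \<Gamma> e else tail \<Gamma> e) [(e, \<not> s)] u"
    using Cons.prems a by auto
  moreover have "edge_path \<Gamma> v (inv_word \<gamma>) (if s then head \<Gamma> e else tail \<Gamma> e)"
    using Cons a by (simp only: edge_path.simps)
  ultimately have "edge_path \<Gamma> v (inv_word \<gamma> @ [(e, \<not> s)]) u"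
    using edge_path_append by metis
  then show ?case
    by (simp add: a inv_word_def inv_letter_def)
qed (simp add: inv_word_def)

lemma edge_path_deck:
  assumes "deck_transformation \<Gamma> p q f g" "edge_path \<Gamma> u \<gamma> v"
  shows "edge_path \<Gamma> (f u) (map (map_prod g id) \<gamma>) (f v)"
  using assms(2,1)
  by (induction \<Gamma> u \<gamma> v rule: edge_path.induct) (auto simp: deck_transformation_def bij_betw_def)

lemma edge_path_lift:
  assumes cov: "covering_map \<Gamma> (rose n) p q" and "u \<in> verts \<Gamma>" "fst ` set w \<subseteq> {1..n}"
  obtains \<gamma> v where "edge_path \<Gamma> u \<gamma> v" "map (map_prod q id) \<gamma> = w"
proof -
  note wf = covering_map_wf[OF cov]
  have "\<exists>\<gamma> v. edge_path \<Gamma> u \<gamma> v \<and> map (map_prod q id) \<gamma> = w"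
    using assms(2,3)
  proof (induction w arbitrary: u)
    case (Cons a w)
    obtain x s where a: "a = (x, s)"
      by fastforce
    have "x \<in> {1..n}"
      using Cons.prems a by auto
    then have "x \<in> q ` {e \<in> arcs \<Gamma>. tail \<Gamma> e = u}" "x \<in> q ` {e \<in> arcs \<Gamma>. head \<Gamma> e = u}"
      by (simp_all only: covering_map_rose(2,3)[OF cov Cons.prems(1)])
    \<comment> \<open>A positive letter lifts to an edge leaving \<open>u\<close>, a negative one to
      an edge entering \<open>u\<close> and traversed backwards.\<close>
    then obtain e where e: "e \<in> arcs \<Gamma>" "q e = x" "u = (if s then tail \<Gamma> e else head \<Gamma> e)"
      by (cases s) auto
    moreover have "(if s then head \<Gamma> e else tail \<Gamma> e) \<in> verts \<Gamma>"
      using e(1) wf_digraph.head_in_verts[OF wf] wf_digraph.tail_in_verts[OF wf] by simp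
    moreover have "fst ` set w \<subseteq> {1..n}"
      using Cons.prems by simp
    ultimately obtain \<gamma> v where
      "edge_path \<Gamma> (if s then head \<Gamma> e else tail \<Gamma> e) \<gamma> v" "map (map_prod q id) \<gamma> = w"
      using Cons.IH by blast
    with e a have "edge_path \<Gamma> u ((e, s) # \<gamma>) v \<and> map (map_prod q id) ((e, s) # \<gamma>) = a # w"
      by simp
    then show ?case
      by (intro exI)
  qed auto
  then show ?thesis
    using that by blast
qed

section \<open>Elements of the free group represented by edge paths\<close>

lemma path_image_in_carrier:
  assumes "covering_map \<Gamma> (rose n) p q" "edge_path \<Gamma> u \<gamma> v"
  shows "path_image q \<gamma> \<in> carrier (F n)"
proof -
  have "fst ` set (map (map_prod q id) \<gamma>) = q ` fst ` set \<gamma>"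
    by (simp add: image_image)
  also have "\<dots> \<subseteq> {1..n}"
    using covering_map_rose(1)[OF assms(1)] edge_path_arcs[OF assms(2)] by blast
  finally have "fst ` set (reduce (map (map_prod q id) \<gamma>)) \<subseteq> {1..n}"
    using set_reduce by (metis image_mono order_trans)
  then show ?thesis
    by (simp add: path_image_def free_group_def reduced_reduce)
qed

text \<open>Reducing the factors first does not change the reduced product. The parameter
  \<open>n\<close> occurs only on the right, since the multiplication of \<open>free_group\<close>
  does not depend on the generators; uses therefore instantiate it.\<close>

lemma path_image_append:
  "path_image q (\<gamma> @ \<delta>) = path_image q \<gamma> \<otimes>\<^bsub>F n\<^esub> path_image q \<delta>"
  by (simp add: path_image_def free_group_def reduce_append_left reduce_append_right)

lemma path_image_inv_word:
  assumes "covering_map \<Gamma> (rose n) p q" "edge_path \<Gamma> u \<gamma> v"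
  shows "path_image q (inv_word \<gamma>) = inv\<^bsub>F n\<^esub> path_image q \<gamma>"
proof -
  note wf = covering_map_wf[OF assms(1)]
  have "map (map_prod q id) (inv_word \<gamma>) = inv_word (map (map_prod q id) \<gamma>)"
    by (auto simp: inv_word_def inv_letter_def rev_map)
  then have "path_image q (inv_word \<gamma>) \<otimes>\<^bsub>F n\<^esub> path_image q \<gamma> = \<one>\<^bsub>F n\<^esub>"
    by (simp add: path_image_def free_group_def reduce_append_left reduce_append_right
        reduce_inv_word)
  then show ?thesis
    using group.inv_equality[OF group_free_group] path_image_in_carrier[OF assms(1)]
      assms(2) edge_path_inv_word[OF wf assms(2)] by metis
qed

text \<open>Normality: a deck transformation moves a loop at \<open>v\<^sub>0\<close> to the end of a lift of the conjugator.\<close>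

lemma \<pi>\<^sub>1_normal:
  assumes reg: "regular_cover \<Gamma> (rose n) p q" and v\<^sub>0: "v\<^sub>0 \<in> verts \<Gamma>"
  shows "\<pi>\<^sub>1 \<Gamma> q v\<^sub>0 \<lhd> F n"
proof -
  interpret group "F n"
    by (rule group_free_group)
  have cov: "covering_map \<Gamma> (rose n) p q"
    using reg by (simp add: regular_cover_def)
  note wf = covering_map_wf[OF cov]
  show ?thesis
  proof (rule normal_invI)
    show "subgroup (\<pi>\<^sub>1 \<Gamma> q v\<^sub>0) (F n)"
    proof (rule subgroupI)
      show "\<pi>\<^sub>1 \<Gamma> q v\<^sub>0 \<subseteq> carrier (F n)"
        using path_image_in_carrier[OF cov] by (auto simp: \<pi>\<^sub>1_def)
      show "\<pi>\<^sub>1 \<Gamma> q v\<^sub>0 \<noteq> {}"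
        using v\<^sub>0 by (auto simp: \<pi>\<^sub>1_def intro: exI[of _ "[]"])
      show "inv\<^bsub>F n\<^esub> a \<in> \<pi>\<^sub>1 \<Gamma> q v\<^sub>0" if "a \<in> \<pi>\<^sub>1 \<Gamma> q v\<^sub>0" for a
        using that path_image_inv_word[OF cov] edge_path_inv_word[OF wf]
        unfolding \<pi>\<^sub>1_def by (smt (verit) mem_Collect_eq)
      show "a \<otimes>\<^bsub>F n\<^esub> b \<in> \<pi>\<^sub>1 \<Gamma> q v\<^sub>0" if "a \<in> \<pi>\<^sub>1 \<Gamma> q v\<^sub>0" "b \<in> \<pi>\<^sub>1 \<Gamma> q v\<^sub>0" for a b
        using that path_image_append[of q _ _ n] edge_path_append
        unfolding \<pi>\<^sub>1_def by (smt (verit) mem_Collect_eq)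
    qed
  next
    fix g x assume g: "g \<in> carrier (F n)" and "x \<in> \<pi>\<^sub>1 \<Gamma> q v\<^sub>0"
    then obtain \<gamma> where \<gamma>: "edge_path \<Gamma> v\<^sub>0 \<gamma> v\<^sub>0" "x = path_image q \<gamma>"
      by (auto simp: \<pi>\<^sub>1_def)
    have "fst ` set g \<subseteq> {1..n}" "reduced g"
      using g by (auto simp: free_group_def)
    \<comment> \<open>As \<open>g\<close> is already reduced, its lift represents exactly
      \<open>g\<close>.\<close>
    then obtain \<delta> u where \<delta>: "edge_path \<Gamma> v\<^sub>0 \<delta> u" "path_image q \<delta> = g"
      using edge_path_lift[OF cov v\<^sub>0] by (metis path_image_def reduce_reduced)
    have "u \<in> verts \<Gamma>"
      using edge_path_end_in_verts[OF \<delta>(1)] .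
    \<comment> \<open>The rose has one vertex, so \<open>u\<close> and \<open>v\<^sub>0\<close> lie
      in the same fibre and regularity applies.\<close>
    then obtain f h where fh: "deck_transformation \<Gamma> p q f h" "f v\<^sub>0 = u"
      using reg v\<^sub>0 unfolding regular_cover_def by (metis (full_types) old.unit.exhaust)
    let ?\<gamma>' = "map (map_prod h id) \<gamma>"
    have \<gamma>': "edge_path \<Gamma> u ?\<gamma>' u"
      using edge_path_deck[OF fh(1) \<gamma>(1)] fh(2) by simp
    \<comment> \<open>Deck transformations preserve the labels \<open>q\<close>, so the translated
      loop represents the same element.\<close>
    have "map (map_prod q id) ?\<gamma>' = map (map_prod q id) \<gamma>"
      using fh(1) edge_path_arcs[OF \<gamma>(1)] by (auto simp: deck_transformation_def)
    then have "path_image q ?\<gamma>' = x"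
      by (simp only: path_image_def \<gamma>(2))
    then have "g \<otimes>\<^bsub>F n\<^esub> x \<otimes>\<^bsub>F n\<^esub> inv\<^bsub>F n\<^esub> g = path_image q ((\<delta> @ ?\<gamma>') @ inv_word \<delta>)"
      using \<delta>(2) path_image_inv_word[OF cov \<delta>(1)] by (simp only: path_image_append[of _ _ _ n])
    moreover have "edge_path \<Gamma> v\<^sub>0 ((\<delta> @ ?\<gamma>') @ inv_word \<delta>) v\<^sub>0"
      using edge_path_append[OF edge_path_append[OF \<delta>(1) \<gamma>'] edge_path_inv_word[OF wf \<delta>(1)]] .
    ultimately show "g \<otimes>\<^bsub>F n\<^esub> x \<otimes>\<^bsub>F n\<^esub> inv\<^bsub>F n\<^esub> g \<in> \<pi>\<^sub>1 \<Gamma> q v\<^sub>0"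
      unfolding \<pi>\<^sub>1_def by blast
  qed
qed


section \<open>Homology and the graph\<close>

text \<open>Joining a closed curve to the base point conjugates its element by that of the joining
  path, and \<open>C_sep\<close> is invariant under this. Conversely, a loop at the base point needs
  only the empty joining path.\<close>

lemma H\<^sub>1_sep_eq:
  assumes cov: "covering_map \<Gamma> (rose n) p q" and v\<^sub>0: "v\<^sub>0 \<in> verts \<Gamma>"
  shows "H\<^sub>1_sep n \<Gamma> q v\<^sub>0 =
    generate (H\<^sub>1 n \<Gamma> q v\<^sub>0) (homology_class n \<Gamma> q v\<^sub>0 ` (C_sep n \<inter> \<pi>\<^sub>1 \<Gamma> q v\<^sub>0))"
proof -
  interpret group "F n"
    by (rule group_free_group)
  note wf = covering_map_wf[OF cov]
  have "{path_image q (\<delta> @ \<gamma> @ inv_word \<delta>) |u \<delta> \<gamma>.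
      edge_path \<Gamma> v\<^sub>0 \<delta> u \<and> edge_path \<Gamma> u \<gamma> u \<and> path_image q \<gamma> \<in> C_sep n}
    = C_sep n \<inter> \<pi>\<^sub>1 \<Gamma> q v\<^sub>0" (is "?L = ?R")
  proof
    show "?L \<subseteq> ?R"
    proof clarify
      fix u \<delta> \<gamma>
      assume \<delta>: "edge_path \<Gamma> v\<^sub>0 \<delta> u" and \<gamma>: "edge_path \<Gamma> u \<gamma> u" "path_image q \<gamma> \<in> C_sep n"
      let ?d = "path_image q \<delta>"
      have d: "?d \<in> carrier (F n)"
        using path_image_in_carrier[OF cov \<delta>] .
      have "path_image q (\<delta> @ \<gamma> @ inv_word \<delta>) = ?d \<otimes>\<^bsub>F n\<^esub> path_image q \<gamma> \<otimes>\<^bsub>F n\<^esub> inv\<^bsub>F n\<^esub> ?d"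
        using path_image_inv_word[OF cov \<delta>] d path_image_in_carrier[OF cov \<gamma>(1)]
        by (simp add: path_image_append[of _ _ _ n] m_assoc)
      moreover have "edge_path \<Gamma> v\<^sub>0 (\<delta> @ \<gamma> @ inv_word \<delta>) v\<^sub>0"
        using edge_path_append[OF \<delta> edge_path_append[OF \<gamma>(1) edge_path_inv_word[OF wf \<delta>]]] .
      then have "path_image q (\<delta> @ \<gamma> @ inv_word \<delta>) \<in> \<pi>\<^sub>1 \<Gamma> q v\<^sub>0"
        unfolding \<pi>\<^sub>1_def by blast
      ultimately show "path_image q (\<delta> @ \<gamma> @ inv_word \<delta>) \<in> ?R"
        using C_sep_conj[OF \<gamma>(2) d] by simp
    qed
    show "?R \<subseteq> ?L"
    proof
      fix x assume "x \<in> ?R"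
      then obtain \<gamma> where \<gamma>: "edge_path \<Gamma> v\<^sub>0 \<gamma> v\<^sub>0" "x = path_image q \<gamma>" "path_image q \<gamma> \<in> C_sep n"
        by (auto simp: \<pi>\<^sub>1_def)
      then have "x = path_image q ([] @ \<gamma> @ inv_word [])" "edge_path \<Gamma> v\<^sub>0 [] v\<^sub>0"
        using v\<^sub>0 by (simp_all add: inv_word_def)
      with \<gamma> show "x \<in> ?L"
        by blast
    qed
  qed
  then have "{homology_class n \<Gamma> q v\<^sub>0 (path_image q (\<delta> @ \<gamma> @ inv_word \<delta>)) |u \<delta> \<gamma>.
      edge_path \<Gamma> v\<^sub>0 \<delta> u \<and> edge_path \<Gamma> u \<gamma> u \<and> path_image q \<gamma> \<in> C_sep n}
    = homology_class n \<Gamma> q v\<^sub>0 ` (C_sep n \<inter> \<pi>\<^sub>1 \<Gamma> q v\<^sub>0)"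
    by (simp only: flip: \<open>?L = ?R\<close>) blast
  then show ?thesis
    by (simp only: H\<^sub>1_sep_def)
qed

text \<open>The correspondence of subgroups, applied inside the fundamental group to its commutator
  subgroup and to \<open>C_sep\<close>; together these two make up \<open>E\<^sub>1\<close>.\<close>

lemma H\<^sub>1_sep_eq_carrier_iff:
  assumes cov: "covering_map \<Gamma> (rose n) p q" and v\<^sub>0: "v\<^sub>0 \<in> verts \<Gamma>"
    and sub: "subgroup (\<pi>\<^sub>1 \<Gamma> q v\<^sub>0) (F n)"
  shows "H\<^sub>1_sep n \<Gamma> q v\<^sub>0 = carrier (H\<^sub>1 n \<Gamma> q v\<^sub>0) \<longleftrightarrow> generate (F n) (E\<^sub>1 n \<Gamma> q v\<^sub>0) = \<pi>\<^sub>1 \<Gamma> q v\<^sub>0"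
proof -
  interpret group "F n"
    by (rule group_free_group)
  let ?P = "\<pi>\<^sub>1 \<Gamma> q v\<^sub>0"
  let ?G = "F n\<lparr>carrier := ?P\<rparr>"
  have "derived (F n) ?P \<lhd> ?G"
    using derived_subgroup_is_normal[OF sub] .
  from normal.generate_FactGroup_eq_carrier_iff[OF this, of "C_sep n \<inter> ?P"]
  have "H\<^sub>1_sep n \<Gamma> q v\<^sub>0 = carrier (H\<^sub>1 n \<Gamma> q v\<^sub>0) \<longleftrightarrow> generate ?G (E\<^sub>1 n \<Gamma> q v\<^sub>0) = ?P"
    by (simp add: H\<^sub>1_sep_eq[OF cov v\<^sub>0] H\<^sub>1_def E\<^sub>1_def homology_class_def[abs_def] r_coset_def[abs_def])
  \<comment> \<open>Since the labels lie in \<open>?P\<close>, they generate the same subgroup in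
    \<open>?G\<close> as in \<open>F n\<close>.\<close>
  moreover have "E\<^sub>1 n \<Gamma> q v\<^sub>0 \<subseteq> ?P"
    using derived_incl[OF order_refl sub] by (auto simp: E\<^sub>1_def)
  ultimately show ?thesis
    using generate_consistent[OF _ sub] by simp
qed

section \<open>The subgroup generated by the labels, and connectedness\<close>

lemma generate_E\<^sub>1_normal:
  assumes P: "\<pi>\<^sub>1 \<Gamma> q v\<^sub>0 \<lhd> F n"
  shows "generate (F n) (E\<^sub>1 n \<Gamma> q v\<^sub>0) \<lhd> F n"
proof -
  interpret group "F n"
    by (rule group_free_group)
  \<comment> \<open>The commutator subgroup is characteristic in the normal subgroup, hence normal
    in the whole group.\<close>
  note D = derived_is_normal[OF P]
  show ?thesis
  proof (rule normal_generateI)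
    show "E\<^sub>1 n \<Gamma> q v\<^sub>0 \<subseteq> carrier (F n)"
      using C_sep_subset subgroup.subset[OF normal_invE(1)[OF D]] by (auto simp: E\<^sub>1_def)
    show "g \<otimes>\<^bsub>F n\<^esub> h \<otimes>\<^bsub>F n\<^esub> inv\<^bsub>F n\<^esub> g \<in> E\<^sub>1 n \<Gamma> q v\<^sub>0"
      if "h \<in> E\<^sub>1 n \<Gamma> q v\<^sub>0" "g \<in> carrier (F n)" for h g
      using that C_sep_conj normal_invE(2)[OF P] normal_invE(2)[OF D] by (auto simp: E\<^sub>1_def)
  qed
qed

lemma HSC\<^sub>1_connected_iff:
  assumes P: "\<pi>\<^sub>1 \<Gamma> q v\<^sub>0 \<lhd> F n"
  shows "Digraph_Component.connected (HSC\<^sub>1 n \<Gamma> q v\<^sub>0) \<longleftrightarrow> generate (F n) (E\<^sub>1 n \<Gamma> q v\<^sub>0) = \<pi>\<^sub>1 \<Gamma> q v\<^sub>0"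
proof -
  interpret group "F n"
    by (rule group_free_group)
  let ?P = "\<pi>\<^sub>1 \<Gamma> q v\<^sub>0" and ?E = "E\<^sub>1 n \<Gamma> q v\<^sub>0" and ?H = "HSC\<^sub>1 n \<Gamma> q v\<^sub>0"
  let ?S = "generate (F n) ?E" and ?cl = "conjugacy_class (F n)"
  let ?R = "parcs (mk_symmetric ?H)"
  note sub = normal_invE(1)[OF P] and S = generate_E\<^sub>1_normal[OF P]
  interpret P: subgroup ?P "F n"
    by (rule sub)
  have EP: "?E \<subseteq> ?P"
    using derived_incl[OF order_refl sub] by (auto simp: E\<^sub>1_def)
  have SP: "?S \<subseteq> ?P"
    using generate_subgroup_incl[OF EP sub] .
  \<comment> \<open>Connectedness ignores directions: it is strong connectedness of the symmetric
    closure, whose adjacency is \<open>?R\<close>. The vertex set is nonempty because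
    \<open>?P\<close> is.\<close>
  have conn: "Digraph_Component.connected ?H \<longleftrightarrow>
    (\<forall>u\<in>?P. \<forall>v\<in>?P. (?cl u, ?cl v) \<in> rtrancl_on (?cl ` ?P) ?R)"
    using sub subgroup_nonempty[of "F n"]
    by (auto simp: Digraph_Component.connected_def strongly_connected_def reachable_def HSC\<^sub>1_def)
  have HSC_ends: "tail ?H e = fst e" "head ?H e = snd (snd e)" for e
    by (simp_all add: HSC\<^sub>1_def split_beta)
  show ?thesis
  proof
    assume C: "Digraph_Component.connected ?H"
    have step: "y \<in> ?cl ` ?P \<and> y \<subseteq> ?S" if x: "x \<subseteq> ?S" and xy: "(x, y) \<in> ?R" for x y
    proof -
      obtain v \<alpha> w g h c where e: "v \<in> ?P" "\<alpha> \<in> ?E" "w \<in> ?P" "g \<in> ?cl v" "h \<in> ?cl w"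
        "c \<in> carrier (F n)" "g \<otimes>\<^bsub>F n\<^esub> (c \<otimes>\<^bsub>F n\<^esub> \<alpha> \<otimes>\<^bsub>F n\<^esub> inv\<^bsub>F n\<^esub> c) = h"
        and cases: "x = ?cl v \<and> y = ?cl w \<or> x = ?cl w \<and> y = ?cl v"
        using xy by (auto simp: parcs_mk_symmetric HSC\<^sub>1_def)
      have g: "g \<in> carrier (F n)"
        using conjugacy_class_normal[OF P e(1)] e(4) P.subset by blast
      have a: "c \<otimes>\<^bsub>F n\<^esub> \<alpha> \<otimes>\<^bsub>F n\<^esub> inv\<^bsub>F n\<^esub> c \<in> ?S" (is "?a \<in> _")
        using normal_invE(2)[OF S e(6)] e(2) by (auto intro: generate.incl)
      \<comment> \<open>An equivalence is required because \<open>?R\<close> also contains the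
        reversed edges.\<close>
      have gh: "g \<in> ?S \<longleftrightarrow> h \<in> ?S"
        using mult_in_subgroup_iff[OF normal_invE(1)[OF S] g a] e(7) by simp
      have "v \<in> ?S \<longleftrightarrow> w \<in> ?S"
        using conjugacy_class_mem_normal_iff[OF S _ e(4)] conjugacy_class_mem_normal_iff[OF S _ e(5)] gh
          e(1,3) P.subset by blast
      then have "y \<subseteq> ?S"
        using cases x e(1,3) P.subset conjugacy_class_self conjugacy_class_normal[OF S] by blast
      then show ?thesis
        using cases e(1,3) by blast
    qed
    have "v \<in> ?S" if v: "v \<in> ?P" for v
    proof -
      \<comment> \<open>The walk starts at the class of the identity, which lies in
        \<open>?S\<close>; \<open>step\<close> carries this along it.\<close>
      have "(?cl \<one>\<^bsub>F n\<^esub>, ?cl v) \<in> rtrancl_on (?cl ` ?P) ?R"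
        using C v conn P.one_closed by blast
      then have "?cl v \<subseteq> ?S"
        by (induction rule: rtrancl_on_induct)
          (use step conjugacy_class_normal[OF S generate.one] in blast)+
      then show ?thesis
        using conjugacy_class_self v P.subset by blast
    qed
    then show "?S = ?P"
      using SP by blast
  next
    assume eq: "?S = ?P"
    \<comment> \<open>The edge relation is witnessed by the representatives \<open>u\<close> and
      \<open>u \<otimes> a\<close> themselves, with trivial conjugator.\<close>
    have arc: "(?cl u, ?cl (u \<otimes>\<^bsub>F n\<^esub> a)) \<in> ?R" "(?cl (u \<otimes>\<^bsub>F n\<^esub> a), ?cl u) \<in> ?R"
      if "u \<in> ?P" "a \<in> ?E" for u a
    proof -
      have ua: "u \<in> carrier (F n)" "a \<in> ?P" "a \<in> carrier (F n)"
        using that EP P.subset by auto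
      then have "u \<otimes>\<^bsub>F n\<^esub> (\<one>\<^bsub>F n\<^esub> \<otimes>\<^bsub>F n\<^esub> a \<otimes>\<^bsub>F n\<^esub> inv\<^bsub>F n\<^esub> \<one>\<^bsub>F n\<^esub>) = u \<otimes>\<^bsub>F n\<^esub> a"
        by simp
      then have "\<exists>g\<in>?cl u. \<exists>h\<in>?cl (u \<otimes>\<^bsub>F n\<^esub> a). \<exists>c\<in>carrier (F n).
          g \<otimes>\<^bsub>F n\<^esub> (c \<otimes>\<^bsub>F n\<^esub> a \<otimes>\<^bsub>F n\<^esub> inv\<^bsub>F n\<^esub> c) = h"
        using conjugacy_class_self[OF ua(1)] conjugacy_class_self[OF m_closed[OF ua(1,3)]] one_closed
        by metis
      then have "(?cl u, ?cl a, ?cl (u \<otimes>\<^bsub>F n\<^esub> a)) \<in> arcs ?H"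
        unfolding HSC\<^sub>1_def pre_digraph.select_convs
        by (intro CollectI exI[of _ u] exI[of _ a] exI[of _ "u \<otimes>\<^bsub>F n\<^esub> a"])
          (use that P.m_closed[OF that(1) ua(2)] in \<open>intro conjI refl\<close>)
      then show "(?cl u, ?cl (u \<otimes>\<^bsub>F n\<^esub> a)) \<in> ?R" "(?cl (u \<otimes>\<^bsub>F n\<^esub> a), ?cl u) \<in> ?R"
        unfolding parcs_mk_symmetric by (rule UN_I; simp add: HSC_ends)+
    qed
    \<comment> \<open>The start \<open>u\<close> stays arbitrary in the induction: for a product,
      the second walk begins where the first one ends.\<close>
    have reach: "(?cl u, ?cl (u \<otimes>\<^bsub>F n\<^esub> x)) \<in> rtrancl_on (?cl ` ?P) ?R"
      if "x \<in> ?S" "u \<in> ?P" for x u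
      using that
    proof (induction x arbitrary: u rule: generate.induct)
      case one
      then show ?case
        using P.subset by auto
    next
      case (incl a)
      then have "u \<otimes>\<^bsub>F n\<^esub> a \<in> ?P"
        using EP by auto
      then show ?case
        using rtrancl_on_into_rtrancl_on[OF rtrancl_on_refl arc(1)[OF incl(2,1)]] incl(2)
        by (simp only: imageI)
    next
      case (inv a)
      then have a: "a \<in> ?P" "u \<otimes>\<^bsub>F n\<^esub> inv\<^bsub>F n\<^esub> a \<in> ?P"
        using EP by auto
      \<comment> \<open>An inverse label is realized by the edge labelled by the class of
        \<open>a\<close> into the class of \<open>u\<close>, traversed backwards.\<close>
      have "u \<otimes>\<^bsub>F n\<^esub> inv\<^bsub>F n\<^esub> a \<otimes>\<^bsub>F n\<^esub> a = u"
        using inv(2) a(1) by (simp add: m_assoc)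
      then have "(?cl u, ?cl (u \<otimes>\<^bsub>F n\<^esub> inv\<^bsub>F n\<^esub> a)) \<in> ?R"
        using arc(2)[OF a(2) inv(1)] by (simp only:)
      from rtrancl_on_into_rtrancl_on[OF rtrancl_on_refl this] show ?case
        using inv(2) a(2) by (simp only: imageI)
    next
      case (eng x y)
      have xy: "x \<in> ?P" "y \<in> ?P"
        using eng.hyps SP by blast+
      have "(?cl (u \<otimes>\<^bsub>F n\<^esub> x), ?cl (u \<otimes>\<^bsub>F n\<^esub> x \<otimes>\<^bsub>F n\<^esub> y)) \<in> rtrancl_on (?cl ` ?P) ?R"
        using eng.IH(2)[OF P.m_closed[OF eng.prems xy(1)]] .
      from rtrancl_on_trans[OF eng.IH(1)[OF eng.prems] this] show ?case
        using eng.prems xy by (simp add: m_assoc)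
    qed
    show "Digraph_Component.connected ?H"
      unfolding conn
    proof (intro ballI)
      fix u v assume u: "u \<in> ?P" and v: "v \<in> ?P"
      \<comment> \<open>Right multiplication by this quotient leads from \<open>u\<close> to
        \<open>v\<close>, and it lies in \<open>?P\<close>, which equals \<open>?S\<close>.\<close>
      then have "inv\<^bsub>F n\<^esub> u \<otimes>\<^bsub>F n\<^esub> v \<in> ?S" "u \<otimes>\<^bsub>F n\<^esub> (inv\<^bsub>F n\<^esub> u \<otimes>\<^bsub>F n\<^esub> v) = v"
        unfolding eq by (auto simp: P.m_inv_closed simp flip: m_assoc)
      then show "(?cl u, ?cl v) \<in> rtrancl_on (?cl ` ?P) ?R"
        using reach[OF _ u] by metis
    qed
  qed
qed

theorem proposition1p9:
  fixes n :: nat and \<Gamma> :: "('v, 'e) pre_digraph" and p :: "'v \<Rightarrow> unit" and q :: "'e \<Rightarrow> nat"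
    and v\<^sub>0 :: 'v
  assumes "n \<ge> 2"
    and "regular_cover \<Gamma> (rose n) p q"
    and "finite_index_cover \<Gamma> (rose n) p"
    and "v\<^sub>0 \<in> verts \<Gamma>"
  shows "Digraph_Component.connected (HSC\<^sub>1 n \<Gamma> q v\<^sub>0) \<longleftrightarrow>
    H\<^sub>1_sep n \<Gamma> q v\<^sub>0 = carrier (H\<^sub>1 n \<Gamma> q v\<^sub>0)"
proof -
  have P: "\<pi>\<^sub>1 \<Gamma> q v\<^sub>0 \<lhd> F n"
    using \<pi>\<^sub>1_normal[OF assms(2,4)] .
  have "covering_map \<Gamma> (rose n) p q"
    using assms(2) by (simp add: regular_cover_def)
  \<comment> \<open>Both sides are equivalent to the labels generating the fundamental
    group.\<close>
  from H\<^sub>1_sep_eq_carrier_iff[OF this assms(4) group.normal_invE(1)[OF group_free_group P]]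
  show ?thesis
    using HSC\<^sub>1_connected_iff[OF P] by simp
qed

end
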